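(* Let $\{\phi_i\}_{i=1}^M\subset \mathbb{H}^N$ be a unit norm Riesz sequence (i.e. $\|\phi_i\|=1$ for all $i$) with Riesz bounds $A$ and $B$. Then $\{\phi_i\phi_i^*\}_{i=1}^M$ is also a Riesz sequence (in $\mathbb{H}^{N\times N}$ with the Frobenius inner product) with the same Riesz bounds $A$ and $B$.
   Context: $\mathbb{H}$ denotes $\mathbb{R}$ or $\mathbb{C}$; vectors in $\mathbb{H}^N$ are columns, $\mathbb{H}^N$ has the usual $\ell_2$ inner product, and $\phi\phi^*$ is the $N\times N$ outer product matrix. $\mathbb{H}^{N\times N}$ carries the Frobenius inner product $\langle S,T\rangle_F=\mathrm{Tr}(ST^* )$. A finite sequence $\{x_i\}_{i=1}^M$ in a finite-dimensional inner product space over $\mathbb{H}$ is a Riesz sequence with (lower and upper) Riesz bounds $0<A\le B<\infty$ if $A\sum_{i=1}^M|a_i|^2\le\|\sum_{i=1}^M a_ix_i\|^2\le B\sum_{i=1}^M|a_i|^2$ for all scalars $(a_i)_{i=1}^M\in\mathbb{H}^M$. *)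

theory Defs
  imports "HOL-Analysis.Analysis"
begin

text \<open>
  The class provides one notation for the conjugation of the two scalar fields: the identity
  on the reals, \<open>cnj\<close> on the complex numbers. The theorem refers only to these two instances.
\<close>

class conjugation_field = real_normed_field +
  fixes conjugate :: "'a \<Rightarrow> 'a"
  assumes conjugate_add: "conjugate (x + y) = conjugate x + conjugate y"
    and conjugate_mult: "conjugate (x * y) = conjugate x * conjugate y"
    and mult_conjugate_scaleR: "x * conjugate x = scaleR ((norm x)\<^sup>2) 1"

instantiation real :: conjugation_field
begin

definition conjugate_real :: "real \<Rightarrow> real"
  where "conjugate_real x = x"

instance
  by standard (simp_all add: conjugate_real_def power2_eq_square)

end

instantiation complex :: conjugation_field
begin

definition conjugate_complex :: "complex \<Rightarrow> complex"
  where "conjugate_complex z = cnj z"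

instance
  by standard (simp_all add: conjugate_complex_def complex_norm_square [symmetric]
      flip: of_real_def)

end

lemma mult_conjugate_self: "x * conjugate x = of_real ((norm x)\<^sup>2)"
  by (simp add: mult_conjugate_scaleR of_real_def)

definition l2_inner :: "'h::conjugation_field ^ 'n \<Rightarrow> 'h ^ 'n \<Rightarrow> 'h"
  where "l2_inner x y = (\<Sum>i\<in>UNIV. x $ i * conjugate (y $ i))"

definition conj_transpose :: "'h::conjugation_field ^ 'n ^ 'm \<Rightarrow> 'h ^ 'm ^ 'n"
  where "conj_transpose T = (\<chi> i j. conjugate (T $ j $ i))"

definition frobenius_inner :: "'h::conjugation_field ^ 'n ^ 'n \<Rightarrow> 'h ^ 'n ^ 'n \<Rightarrow> 'h"
  where "frobenius_inner S T = trace (S ** conj_transpose T)"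

definition matrix_scale :: "'h::conjugation_field \<Rightarrow> 'h ^ 'n ^ 'n \<Rightarrow> 'h ^ 'n ^ 'n"
  where "matrix_scale c T = (\<chi> i j. c * T $ i $ j)"

definition outer_self :: "'h::conjugation_field ^ 'n \<Rightarrow> 'h ^ 'n ^ 'n"
  where "outer_self x = (\<chi> i j. x $ i * conjugate (x $ j))"

text \<open>
  The inner product takes values in the scalar field; since \<open>ip v v\<close> is a nonnegative real,
  it is turned into a real number by taking its modulus.
\<close>

definition norm_of :: "('v \<Rightarrow> 'v \<Rightarrow> 'h::conjugation_field) \<Rightarrow> 'v \<Rightarrow> real"
  where "norm_of ip v = sqrt (norm (ip v v))"

text \<open>
  The inner product \<open>ip\<close> and the scalar multiplication \<open>smul\<close> are explicit because the library's
  \<open>inner\<close> and \<open>scaleR\<close> only have real values and real scalars. Only the values of \<open>x\<close> on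
  \<open>{1..M}\<close> matter, and the bounds are not required to be optimal.
\<close>

definition riesz_sequence ::
    "('v \<Rightarrow> 'v \<Rightarrow> 'h::conjugation_field) \<Rightarrow> ('h \<Rightarrow> 'v \<Rightarrow> 'v) \<Rightarrow>
     nat \<Rightarrow> (nat \<Rightarrow> 'v::comm_monoid_add) \<Rightarrow> real \<Rightarrow> real \<Rightarrow> bool"
  where "riesz_sequence ip smul M x A B \<longleftrightarrow>
    0 < A \<and> A \<le> B \<and>
    (\<forall>a :: nat \<Rightarrow> 'h.
       A * (\<Sum>i=1..M. (norm (a i))\<^sup>2) \<le> (norm_of ip (\<Sum>i=1..M. smul (a i) (x i)))\<^sup>2 \<and>
       (norm_of ip (\<Sum>i=1..M. smul (a i) (x i)))\<^sup>2 \<le> B * (\<Sum>i=1..M. (norm (a i))\<^sup>2))"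

text \<open>Both induced norms agree with the norms the library puts on \<open>'h ^ 'n\<close> and \<open>'h ^ 'n ^ 'n\<close>.\<close>

lemma norm_of_l2_inner: "norm_of l2_inner x = norm x"
proof -
  have "l2_inner x x = of_real (\<Sum>i\<in>UNIV. (norm (x $ i))\<^sup>2)"
    by (simp add: l2_inner_def mult_conjugate_self)
  then have "norm (l2_inner x x) = (\<Sum>i\<in>UNIV. (norm (x $ i))\<^sup>2)"
    by (simp only: norm_of_real) (simp add: sum_nonneg)
  then show ?thesis
    by (simp add: norm_of_def norm_vec_def L2_set_def)
qed

lemma norm_of_frobenius_inner: "norm_of frobenius_inner T = norm T"
proof -
  have "frobenius_inner T T = of_real (\<Sum>i\<in>UNIV. \<Sum>j\<in>UNIV. (norm (T $ i $ j))\<^sup>2)"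
    by (simp add: frobenius_inner_def trace_def matrix_matrix_mult_def conj_transpose_def
        mult_conjugate_self)
  then have "norm (frobenius_inner T T) = (\<Sum>i\<in>UNIV. \<Sum>j\<in>UNIV. (norm (T $ i $ j))\<^sup>2)"
    by (simp only: norm_of_real) (simp add: sum_nonneg)
  then show ?thesis
    by (simp add: norm_of_def norm_vec_def L2_set_def sum_nonneg)
qed

end

theory Submission imports Defs begin

text \<open>
  The \<open>j\<close>-th column of \<open>\<Sum>i. a i \<phi> i (\<phi> i)\<^sup>*\<close> is \<open>\<Sum>i. (a i \<cdot> conjugate (\<phi> i $ j)) \<phi> i\<close>, a linear
  combination of the original vectors. The Riesz bounds of \<open>\<phi>\<close> therefore place its squared norm
  between \<open>A\<close> and \<open>B\<close> times \<open>\<Sum>i. \<bar>a i\<bar>\<^sup>2 \<bar>\<phi> i $ j\<bar>\<^sup>2\<close>. Summing over the columns gives the squared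
  Frobenius norm in the middle, and on both sides the unit norms \<open>\<Sum>j. \<bar>\<phi> i $ j\<bar>\<^sup>2 = 1\<close> turn the sum
  into \<open>\<Sum>i. \<bar>a i\<bar>\<^sup>2\<close>. The argument is the same over both scalar fields, so it is carried out once,
  over an arbitrary field with a conjugation.
\<close>

lemma norm_conjugate: "norm (conjugate x) = norm (x :: 'h::conjugation_field)"
proof (cases "x = 0")
  case True
  have "conjugate (0 :: 'h) = conjugate 0 + conjugate 0"
    using conjugate_add [of "0 :: 'h" 0] by simp
  then show ?thesis
    using True by simp
next
  case False
  have "norm x * norm (conjugate x) = norm (x * conjugate x)"
    by (simp add: norm_mult)
  also have "\<dots> = norm x * norm x"
    by (simp add: mult_conjugate_scaleR power2_eq_square)
  finally show ?thesis
    using False by simp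
qed

lemma norm_vec_squared:
  fixes x :: "'a::real_normed_vector ^ 'n"
  shows "(norm x)\<^sup>2 = (\<Sum>i\<in>UNIV. (norm (x $ i))\<^sup>2)"
  by (simp add: norm_vec_def L2_set_def sum_nonneg)

lemma norm_matrix_squared_columns:
  fixes T :: "'h::real_normed_field ^ 'n ^ 'm"
  shows "(norm T)\<^sup>2 = (\<Sum>j\<in>UNIV. (norm (column j T))\<^sup>2)"
proof -
  have "(norm T)\<^sup>2 = (\<Sum>i\<in>UNIV. \<Sum>j\<in>UNIV. (norm (T $ i $ j))\<^sup>2)"
    by (simp add: norm_vec_squared)
  also have "\<dots> = (\<Sum>j\<in>UNIV. \<Sum>i\<in>UNIV. (norm (T $ i $ j))\<^sup>2)"
    by (rule sum.swap)
  finally show ?thesis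
    by (simp add: norm_vec_squared column_def)
qed

lemma column_sum_outer_self:
  "column j (\<Sum>i\<in>I. matrix_scale (a i) (outer_self (\<phi> i))) =
     (\<Sum>i\<in>I. (a i * conjugate (\<phi> i $ j)) *s \<phi> i)"
  by (simp add: vec_eq_iff column_def matrix_scale_def outer_self_def mult_ac)

text \<open>
  The coefficients that represent the columns carry, all together, exactly the energy of \<open>a\<close>;
  this is where unit norms enter, and why the bounds do not change.
\<close>

lemma sum_column_coefficients:
  fixes \<phi> :: "'i \<Rightarrow> 'h::conjugation_field ^ 'n"
  assumes unit: "\<And>i. i \<in> I \<Longrightarrow> norm (\<phi> i) = 1"
  shows "(\<Sum>j\<in>UNIV. \<Sum>i\<in>I. (norm (a i * conjugate (\<phi> i $ j)))\<^sup>2) = (\<Sum>i\<in>I. (norm (a i))\<^sup>2)"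
proof -
  have "(\<Sum>j\<in>UNIV. \<Sum>i\<in>I. (norm (a i * conjugate (\<phi> i $ j)))\<^sup>2) =
      (\<Sum>i\<in>I. \<Sum>j\<in>UNIV. (norm (a i * conjugate (\<phi> i $ j)))\<^sup>2)"
    by (rule sum.swap)
  also have "\<dots> = (\<Sum>i\<in>I. (norm (a i))\<^sup>2 * (norm (\<phi> i))\<^sup>2)"
    by (simp add: norm_mult norm_conjugate power_mult_distrib norm_vec_squared sum_distrib_left)
  also have "\<dots> = (\<Sum>i\<in>I. (norm (a i))\<^sup>2)"
    by (simp add: unit)
  finally show ?thesis .
qed

lemma riesz_sequence_outer_self:
  fixes \<phi> :: "nat \<Rightarrow> 'h::conjugation_field ^ 'n"
  assumes unit: "\<And>i. i \<in> {1..M} \<Longrightarrow> norm_of l2_inner (\<phi> i) = 1"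
    and riesz: "riesz_sequence l2_inner (*s) M \<phi> A B"
  shows "riesz_sequence frobenius_inner matrix_scale M (\<lambda>i. outer_self (\<phi> i)) A B"
proof -
  have bounds: "A * (\<Sum>i=1..M. (norm (c i))\<^sup>2) \<le> (norm (\<Sum>i=1..M. c i *s \<phi> i))\<^sup>2"
      "(norm (\<Sum>i=1..M. c i *s \<phi> i))\<^sup>2 \<le> B * (\<Sum>i=1..M. (norm (c i))\<^sup>2)" for c
    using riesz by (auto simp: riesz_sequence_def norm_of_l2_inner)
  have "A * (\<Sum>i=1..M. (norm (a i))\<^sup>2)
          \<le> (norm (\<Sum>i=1..M. matrix_scale (a i) (outer_self (\<phi> i))))\<^sup>2 \<and>
        (norm (\<Sum>i=1..M. matrix_scale (a i) (outer_self (\<phi> i))))\<^sup>2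
          \<le> B * (\<Sum>i=1..M. (norm (a i))\<^sup>2)" for a
  proof -
    let ?c = "\<lambda>j i. a i * conjugate (\<phi> i $ j)"
    have energy: "(\<Sum>j\<in>UNIV. \<Sum>i=1..M. (norm (?c j i))\<^sup>2) = (\<Sum>i=1..M. (norm (a i))\<^sup>2)"
      using unit by (intro sum_column_coefficients) (simp add: norm_of_l2_inner)
    have columns: "(norm (\<Sum>i=1..M. matrix_scale (a i) (outer_self (\<phi> i))))\<^sup>2 =
        (\<Sum>j\<in>UNIV. (norm (\<Sum>i=1..M. ?c j i *s \<phi> i))\<^sup>2)"
      by (simp only: norm_matrix_squared_columns column_sum_outer_self)
    show ?thesis
      unfolding columns energy [symmetric] sum_distrib_left [of _ _ UNIV]
      by (intro conjI sum_mono bounds)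
  qed
  then show ?thesis
    using riesz by (simp add: riesz_sequence_def norm_of_frobenius_inner)
qed

theorem corollary2p7:
  fixes M :: nat and A B :: real
  shows
    "(\<forall>\<phi> :: nat \<Rightarrow> real ^ 'n.
        (\<forall>i\<in>{1..M}. norm_of l2_inner (\<phi> i) = 1) \<longrightarrow>
        riesz_sequence l2_inner (*s) M \<phi> A B \<longrightarrow>
        riesz_sequence frobenius_inner matrix_scale M (\<lambda>i. outer_self (\<phi> i)) A B) \<and>
     (\<forall>\<phi> :: nat \<Rightarrow> complex ^ 'n.
        (\<forall>i\<in>{1..M}. norm_of l2_inner (\<phi> i) = 1) \<longrightarrow>
        riesz_sequence l2_inner (*s) M \<phi> A B \<longrightarrow>
        riesz_sequence frobenius_inner matrix_scale M (\<lambda>i. outer_self (\<phi> i)) A B)"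
  by (intro conjI allI impI; rule riesz_sequence_outer_self; blast)

end
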